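(* Assume that there exist sets $\mathcal J_1,\dots,\mathcal J_K\subset\{1,\dots,d\}$ such that $$\inf_{j=1,\dots,K}\ \inf_{k\in\mathcal J_j}\ \sup_{\tau\in\mathcal T_j}|\beta_k(\tau)|>0,\qquad\sup_{j=1,\dots,K}\ \sup_{k\in\mathcal J_j^C}\ \sup_{\tau\in\mathcal T_j}|\beta_k(\tau)|=0,$$ and that $\sqrt n\,\lambda_n\to0$ and $n\lambda_n\to\infty$. If the preliminary estimator $\tilde\beta$ is uniformly consistent for $\beta$ with rate $O_P(1/\sqrt n)$ on the interval $[\tau_L,\tau_U]$, then the average penalties $$p_k^{int}(n,\tau):=\sum_{j=1}^KI\{\tau\in\mathcal T_j\}\int_{\mathcal T_j}|\tilde\beta_k(t)|\,h(t)\,dt,\qquad p_k^{max}(n,\tau):=\sum_{j=1}^KI\{\tau\in\mathcal T_j\}\sup_{t\in\mathcal T_j}|\tilde\beta_k(t)|,\qquad k=1,\dots,d,$$ satisfy condition (P) stated in the context, with $\chi(\tau)=\mathcal J_j$ for $\tau\in\mathcal T_j$.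
   Context: $\beta=(\beta_1,\dots,\beta_d):[\tau_L,\tau_U]\to\mathbb{R}^d$, $[\tau_L,\tau_U]\subset[0,1)$, is the coefficient function of a linear conditional quantile model (the $\tau$-quantile of a response $T$ given a covariate $Z\in\mathbb{R}^d$ is $Z^t\beta(\tau)$), assumed Lipschitz continuous: $\|\beta(\tau)-\beta(\tau')\|\le C_4|\tau-\tau'|$ for a finite constant $C_4$ and all $\tau,\tau'$ ($\|\cdot\|$ the maximum norm). $\tau_0=\tau_L$. $\mathcal T_1,\dots,\mathcal T_K$ is a fixed, disjoint partition of $[\tau_0,\tau_U]$. $h$ is a strictly positive, uniformly bounded weight function integrating to one. $\tilde\beta$ is a (data-dependent) preliminary estimator of $\beta$ based on sample size $n$; uniform consistency with rate $O_P(1/\sqrt n)$ means $\sup_{\tau}\|\tilde\beta(\tau)-\beta(\tau)\|=O_P(n^{-1/2})$. $\lambda_n>0$ is a sequence of regularization parameters; $\tau_0=\tau_L<\tau_1<\dots<\tau_{N_\tau(n)}=\tau_U$ is a uniformly spaced grid of width $a_n=o(n^{-1/2})$; $p_k(n,\tau_j)$ denotes the penalty of component $k$ at grid point $\tau_j$ (penalty term proportional to $\lambda_n\sum_k|b_k|/p_k(n,\tau_j)$), with $\lambda_n/0:=\infty$. Condition (P): there is a map $\chi$ from $[\tau_L,\tau_U]$ to the subsets of $\{1,\dots,d\}$ such that $\beta_k(\tau)=0$ for all $k\in\chi(\tau)^C$, $\tau\in[\tau_L,\tau_U]$, and $$\sqrt n\,\inf_j\inf_{k\in\chi(\tau_j)^C}\frac{\lambda_n}{p_k(n,\tau_j)}\to\infty\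 \text{in probability},\qquad\sup_j\sup_{k\in\chi(\tau_j)}\frac{\lambda_n}{p_k(n,\tau_j)}=o_P(1/\sqrt n)$$ ($j$ ranging over the grid indices). Moreover, there are real numbers $\tau_L=\theta_1<\dots<\theta_m=\tau_U$ such that $\chi$ is constant on each interval $[\theta_i,\theta_{i+1})$, $i=1,\dots,m-1$.
   Formalization: The cells of the partition are required to be finite unions of nondegenerate half-open intervals [s,t), the last closed at τ_U; for arbitrary disjoint cells χ need not be constant on intervals [θ_i,θ_{i+1}), and the integral penalty vanishes on null cells. *)

theory Defs
  imports "HOL-Probability.Probability" "HOL-Library.Landau_Symbols"
begin

text \<open>
  Suprema and infima of nonnegative quantities are taken in \<^typ>\<open>ennreal\<close>: there the infimum over
  an empty index set is \<open>\<infinity>\<close>, the supremum over one is \<open>0\<close>, and \<open>c / 0 = \<infinity>\<close> for \<open>c > 0\<close>.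

  A supremum over an uncountable set of parameters need not be a measurable function of \<open>\<omega>\<close>, so
  stochastic orders are defined with \<^const>\<open>outer_measure_of\<close>. On measurable events it is
  \<^const>\<open>emeasure\<close> (\<open>outer_measure_of_eq\<close>), which gives back the usual notions.
\<close>

definition bigO_P :: "'w measure \<Rightarrow> (nat \<Rightarrow> real) \<Rightarrow> (nat \<Rightarrow> 'w \<Rightarrow> ennreal) \<Rightarrow> bool" where
  "bigO_P M r X \<longleftrightarrow>
     (\<forall>\<epsilon>>0. \<exists>C>0. \<forall>\<^sub>F n in sequentially.
        outer_measure_of M {\<omega> \<in> space M. X n \<omega> > ennreal (C * r n)} \<le> ennreal \<epsilon>)"

definition smallo_P :: "'w measure \<Rightarrow> (nat \<Rightarrow> real) \<Rightarrow> (nat \<Rightarrow> 'w \<Rightarrow> ennreal) \<Rightarrow> bool" where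
  "smallo_P M r X \<longleftrightarrow>
     (\<forall>\<epsilon>>0. (\<lambda>n. outer_measure_of M {\<omega> \<in> space M. X n \<omega> > ennreal (\<epsilon> * r n)}) \<longlonglongrightarrow> 0)"

definition tends_to_infinity_in_prob :: "'w measure \<Rightarrow> (nat \<Rightarrow> 'w \<Rightarrow> ennreal) \<Rightarrow> bool" where
  "tends_to_infinity_in_prob M X \<longleftrightarrow>
     (\<forall>c>0. (\<lambda>n. outer_measure_of M {\<omega> \<in> space M. X n \<omega> \<le> ennreal c}) \<longlonglongrightarrow> 0)"

definition breakpoints :: "real \<Rightarrow> real \<Rightarrow> nat \<Rightarrow> (nat \<Rightarrow> real) \<Rightarrow> bool" where
  "breakpoints a b m \<theta> \<longleftrightarrow> 2 \<le> m \<and> \<theta> 1 = a \<and> \<theta> m = b \<and> strict_mono_on {1..m} \<theta>"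

text \<open>
  The cells are finite unions of nondegenerate intervals \<open>[\<theta>\<^sub>i, \<theta>\<^sub>i\<^sub>+\<^sub>1)\<close>, the last of these being
  closed at \<open>b\<close>. Single intervals are the typical case. For arbitrary cells, the
  piecewise constancy on intervals \<open>[\<theta>\<^sub>i, \<theta>\<^sub>i\<^sub>+\<^sub>1)\<close> in \<open>condition_P\<close> can fail, and on
  a cell that is a null set the integral penalty vanishes.
\<close>

definition interval_partition :: "real \<Rightarrow> real \<Rightarrow> nat \<Rightarrow> (nat \<Rightarrow> real set) \<Rightarrow> bool" where
  "interval_partition a b K \<T> \<longleftrightarrow>
     disjoint_family_on \<T> {1..K} \<and> (\<Union>j\<in>{1..K}. \<T> j) = {a..b} \<and> (\<forall>j\<in>{1..K}. \<T> j \<noteq> {}) \<and>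
     (\<exists>m \<theta>. breakpoints a b m \<theta> \<and>
        (\<forall>i\<in>{1..<m}. \<exists>j\<in>{1..K}. {\<theta> i..<\<theta> (Suc i)} \<subseteq> \<T> j) \<and>
        (\<exists>j\<in>{1..K}. {\<theta> (m - 1)..b} \<subseteq> \<T> j))"

definition uniform_grid ::
    "real \<Rightarrow> real \<Rightarrow> (nat \<Rightarrow> real) \<Rightarrow> (nat \<Rightarrow> nat) \<Rightarrow> (nat \<Rightarrow> nat \<Rightarrow> real) \<Rightarrow> bool" where
  "uniform_grid \<tau>\<^sub>L \<tau>\<^sub>U a N \<tau> \<longleftrightarrow>
     (\<forall>n. a n > 0 \<and> (\<forall>j\<le>N n. \<tau> n j = \<tau>\<^sub>L + real j * a n) \<and> \<tau> n (N n) = \<tau>\<^sub>U)"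

text \<open>
  A penalty \<open>p\<close> takes the component \<open>k\<close>, the sample size \<open>n\<close>, the quantile level and the
  outcome \<open>\<omega>\<close>. It may be \<open>\<infinity>\<close> where a path of the preliminary estimator is unbounded.
\<close>

definition condition_P ::
    "'w measure \<Rightarrow> real \<Rightarrow> real \<Rightarrow> (real \<Rightarrow> real ^ 'd) \<Rightarrow> (nat \<Rightarrow> real) \<Rightarrow> (nat \<Rightarrow> nat) \<Rightarrow>
     (nat \<Rightarrow> nat \<Rightarrow> real) \<Rightarrow> ('d \<Rightarrow> nat \<Rightarrow> real \<Rightarrow> 'w \<Rightarrow> ennreal) \<Rightarrow> (real \<Rightarrow> 'd set) \<Rightarrow> bool" where
  "condition_P M \<tau>\<^sub>L \<tau>\<^sub>U \<beta> lam N \<tau> p chi \<longleftrightarrow>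
     (\<forall>t\<in>{\<tau>\<^sub>L..\<tau>\<^sub>U}. \<forall>k\<in>- chi t. \<beta> t $ k = 0) \<and>
     tends_to_infinity_in_prob M (\<lambda>n \<omega>. ennreal (sqrt (real n)) *
        (INF j\<in>{..N n}. INF k\<in>- chi (\<tau> n j). ennreal (lam n) / p k n (\<tau> n j) \<omega>)) \<and>
     smallo_P M (\<lambda>n. 1 / sqrt (real n))
        (\<lambda>n \<omega>. SUP j\<in>{..N n}. SUP k\<in>chi (\<tau> n j). ennreal (lam n) / p k n (\<tau> n j) \<omega>) \<and>
     (\<exists>m \<theta>. breakpoints \<tau>\<^sub>L \<tau>\<^sub>U m \<theta> \<and> (\<forall>i\<in>{1..<m}. chi constant_on {\<theta> i..<\<theta> (Suc i)}))"

definition p_int ::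
    "nat \<Rightarrow> (nat \<Rightarrow> real set) \<Rightarrow> (real \<Rightarrow> real) \<Rightarrow> (nat \<Rightarrow> 'w \<Rightarrow> real \<Rightarrow> real ^ 'd) \<Rightarrow>
     'd \<Rightarrow> nat \<Rightarrow> real \<Rightarrow> 'w \<Rightarrow> ennreal" where
  "p_int K \<T> h \<beta>' k n \<tau> \<omega> =
     (\<Sum>j=1..K. indicator (\<T> j) \<tau> * (\<integral>\<^sup>+t\<in>\<T> j. ennreal (\<bar>\<beta>' n \<omega> t $ k\<bar> * h t) \<partial>lborel))"

definition p_max ::
    "nat \<Rightarrow> (nat \<Rightarrow> real set) \<Rightarrow> (nat \<Rightarrow> 'w \<Rightarrow> real \<Rightarrow> real ^ 'd) \<Rightarrow>
     'd \<Rightarrow> nat \<Rightarrow> real \<Rightarrow> 'w \<Rightarrow> ennreal" where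
  "p_max K \<T> \<beta>' k n \<tau> \<omega> =
     (\<Sum>j=1..K. indicator (\<T> j) \<tau> * (SUP t\<in>\<T> j. ennreal \<bar>\<beta>' n \<omega> t $ k\<bar>))"

end

theory Submission
  imports Defs
begin

text \<open>
  Everything is compared with the uniform deviation \<open>D\<^sub>n\<close> of the preliminary estimator from
  \<open>\<beta>\<close>, which is of order \<open>O\<^sub>P(1 / \<surd>n)\<close>.

  If \<open>k \<notin> \<J> j\<close>, then \<open>\<beta>\<^sub>k\<close> vanishes on the cell \<open>\<T> j\<close>, so the preliminary estimator itself is
  at most \<open>D\<^sub>n\<close> there, and so are its maximum and its average with respect to \<open>h\<close>. Hence
  \<open>\<surd>n \<lambda>\<^sub>n / p\<close> is at least of the order \<open>n \<lambda>\<^sub>n\<close>, which diverges.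

  If \<open>k \<in> \<J> j\<close>, then \<open>\<beta>\<^sub>k\<close> is nonzero somewhere in \<open>\<T> j\<close>. Every point of a cell lies in a
  nondegenerate interval inside the cell (\<open>interval_in_cell\<close>), and \<open>\<beta>\<^sub>k\<close> is continuous, so
  \<open>\<bar>\<beta>\<^sub>k\<bar> \<ge> 2 \<delta>\<close> on some interval \<open>[u, v] \<subseteq> \<T> j\<close> with \<open>u < v\<close>
  (\<open>Lipschitz_component_bounded_away\<close>). As soon as \<open>D\<^sub>n \<le> \<delta>\<close>, the estimator is at least \<open>\<delta>\<close> in
  absolute value on \<open>[u, v]\<close>. So the maximum penalty is at least \<open>\<delta>\<close> and the integral
  penalty is at least \<open>\<delta>\<close> times the integral of \<open>h\<close> over \<open>[u, v]\<close>, which is positive because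
  \<open>h\<close> is. With \<open>p\<close> bounded away from \<open>0\<close>, \<open>\<surd>n \<lambda>\<^sub>n / p\<close> tends to \<open>0\<close> with \<open>\<surd>n \<lambda>\<^sub>n\<close>.

  The lemma \<open>penalty_orders_if_deviation_bounds\<close> turns these two comparisons into the stochastic
  orders of condition (P), and \<open>condition_P_if_cellwise_bounds\<close> passes from single cells and
  components to all of them at once. The breakpoints of the partition also serve as the
  breakpoints of the piecewise constant index map.
\<close>

section \<open>Stochastic orders\<close>

text \<open>
  Every probability estimate goes through this rule. The sets \<open>A n\<close> are the events on
  which the conclusion to be proved fails; each is shown to force an exceptionally large \<open>X\<close>.
  Since \<open>C\<close> is arbitrary, it may be taken to be the constant that the definition of
  \<^const>\<open>bigO_P\<close> gives for any tolerance.
\<close>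

lemma outer_measure_tendsto_0_if_bigO_P:
  assumes X: "bigO_P M r X"
    and A: "\<And>C. C > 0 \<Longrightarrow> \<forall>\<^sub>F n in sequentially. A n \<subseteq> {\<omega> \<in> space M. X n \<omega> > ennreal (C * r n)}"
  shows "(\<lambda>n. outer_measure_of M (A n)) \<longlonglongrightarrow> 0"
proof (rule order_tendstoI)
  fix e :: ennreal
  assume "0 < e"
  then obtain e' where e': "0 < e'" "e' < e"
    using dense by blast
  then obtain \<epsilon> where \<epsilon>: "e' = ennreal \<epsilon>" "0 < \<epsilon>"
    by (cases e') auto
  obtain C where C: "C > 0"
    and ev: "\<forall>\<^sub>F n in sequentially.
      outer_measure_of M {\<omega> \<in> space M. X n \<omega> > ennreal (C * r n)} \<le> ennreal \<epsilon>"
    using X \<epsilon>(2) unfolding bigO_P_def by blast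
  show "\<forall>\<^sub>F n in sequentially. outer_measure_of M (A n) < e"
    using ev A[OF C]
  proof eventually_elim
    case (elim n)
    show ?case
      using outer_measure_of_mono[OF elim(2)] elim(1) e' \<epsilon>(1)
      by (metis le_less_trans order_trans)
  qed
qed auto

text \<open>The conventions \<open>c / 0 = \<infinity>\<close> for \<open>c > 0\<close>, \<open>0 / 0 = 0\<close> and \<open>c / \<infinity> = 0\<close> respect the order;
  so the penalty weights \<open>\<lambda>\<^sub>n / p\<close> can be compared although \<open>p\<close> may be \<open>0\<close> or \<open>\<infinity>\<close>.\<close>

lemma divide_left_antimono_ennreal:
  fixes a b c :: ennreal
  assumes "b \<le> c"
  shows "a / c \<le> a / b"
proof -
  have "inverse c \<le> inverse b"
  proof (cases "b = 0 \<or> c = top")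
    case False
    with assms obtain x y where "b = ennreal x" "c = ennreal y" "0 < x" "x \<le> y"
      by (cases b; cases c) (auto simp: ennreal_le_iff top_unique less_le)
    then show ?thesis
      by (auto simp: inverse_ennreal intro!: ennreal_leI le_imp_inverse_le)
  qed auto
  then show ?thesis
    unfolding divide_ennreal_def by (rule mult_left_mono) simp
qed

text \<open>
  On the event \<open>D \<le> C / \<surd>n\<close>, an inactive component has
  \<open>\<surd>n \<lambda>\<^sub>n / p \<ge> \<surd>n \<lambda>\<^sub>n / D \<ge> n \<lambda>\<^sub>n / C\<close>, which diverges. Moreover \<open>C / \<surd>n\<close> eventually drops
  below \<open>\<delta>\<close>, and from then on an active component has \<open>\<surd>n \<lambda>\<^sub>n / p \<le> \<surd>n \<lambda>\<^sub>n / \<delta>\<close>, which tends to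
  \<open>0\<close>. Both bounds are uniform in the quantile level and hence survive the infimum and the
  supremum over the grid.
\<close>

lemma penalty_orders_if_deviation_bounds:
  fixes D :: "nat \<Rightarrow> 'w \<Rightarrow> ennreal" and p :: "'d::finite \<Rightarrow> nat \<Rightarrow> real \<Rightarrow> 'w \<Rightarrow> ennreal"
  assumes D: "bigO_P M (\<lambda>n. 1 / sqrt (real n)) D"
    and lam_pos: "\<And>n. lam n > 0"
    and lam_upper: "(\<lambda>n. sqrt (real n) * lam n) \<longlonglongrightarrow> 0"
    and lam_lower: "filterlim (\<lambda>n. real n * lam n) at_top sequentially"
    and grid: "\<And>n j. j \<le> N n \<Longrightarrow> \<tau> n j \<in> I"
    and upper: "\<And>n \<omega> t k. t \<in> I \<Longrightarrow> k \<notin> chi t \<Longrightarrow> p k n t \<omega> \<le> D n \<omega>"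
    and \<delta>: "\<delta> > 0"
    and lower: "\<And>n \<omega> t k. t \<in> I \<Longrightarrow> k \<in> chi t \<Longrightarrow> D n \<omega> \<le> ennreal \<delta> \<Longrightarrow> ennreal \<delta> \<le> p k n t \<omega>"
  shows "tends_to_infinity_in_prob M (\<lambda>n \<omega>. ennreal (sqrt (real n)) *
        (INF j\<in>{..N n}. INF k\<in>- chi (\<tau> n j). ennreal (lam n) / p k n (\<tau> n j) \<omega>))"
    and "smallo_P M (\<lambda>n. 1 / sqrt (real n))
        (\<lambda>n \<omega>. SUP j\<in>{..N n}. SUP k\<in>chi (\<tau> n j). ennreal (lam n) / p k n (\<tau> n j) \<omega>)"
proof -
  show "tends_to_infinity_in_prob M (\<lambda>n \<omega>. ennreal (sqrt (real n)) *
        (INF j\<in>{..N n}. INF k\<in>- chi (\<tau> n j). ennreal (lam n) / p k n (\<tau> n j) \<omega>))"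
    unfolding tends_to_infinity_in_prob_def
  proof (intro allI impI outer_measure_tendsto_0_if_bigO_P[OF D])
    fix c C :: real
    assume "c > 0" and C: "C > 0"
    have "\<forall>\<^sub>F n in sequentially. c * C < real n * lam n"
      using lam_lower by (simp add: filterlim_at_top_dense)
    with eventually_gt_at_top[of 0]
    show "\<forall>\<^sub>F n in sequentially.
        {\<omega> \<in> space M. ennreal (sqrt (real n)) *
          (INF j\<in>{..N n}. INF k\<in>- chi (\<tau> n j). ennreal (lam n) / p k n (\<tau> n j) \<omega>) \<le> ennreal c}
        \<subseteq> {\<omega> \<in> space M. D n \<omega> > ennreal (C * (1 / sqrt (real n)))}"
    proof eventually_elim
      case (elim n)
      have "ennreal c < ennreal (sqrt (real n)) *
          (INF j\<in>{..N n}. INF k\<in>- chi (\<tau> n j). ennreal (lam n) / p k n (\<tau> n j) \<omega>)"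
        if dev: "D n \<omega> \<le> ennreal (C * (1 / sqrt (real n)))" for \<omega>
      proof -
        have le: "ennreal (lam n / (C * (1 / sqrt (real n)))) \<le> ennreal (lam n) / p k n (\<tau> n j) \<omega>"
          if "j \<le> N n" "k \<notin> chi (\<tau> n j)" for j k
        proof -
          have "p k n (\<tau> n j) \<omega> \<le> ennreal (C * (1 / sqrt (real n)))"
            using upper[OF grid[OF that(1)] that(2)] dev by (rule order_trans)
          then show ?thesis
            using lam_pos[of n] C elim(1)
            by (subst divide_ennreal[symmetric]) (auto intro: divide_left_antimono_ennreal)
        qed
        have "c < real n * lam n / C"
          using elim(2) C by (simp add: field_simps)
        also have "\<dots> = sqrt (real n) * (lam n / (C * (1 / sqrt (real n))))"
          by (simp add: field_simps)
        finally have "ennreal c < ennreal (sqrt (real n)) * ennreal (lam n / (C * (1 / sqrt (real n))))"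
          using \<open>c > 0\<close> lam_pos[of n] C
          by (simp add: ennreal_mult[symmetric] ennreal_lessI)
        also have "\<dots> \<le> ennreal (sqrt (real n)) *
            (INF j\<in>{..N n}. INF k\<in>- chi (\<tau> n j). ennreal (lam n) / p k n (\<tau> n j) \<omega>)"
          using le by (intro mult_left_mono INF_greatest) auto
        finally show ?thesis .
      qed
      then show ?case
        by (intro Collect_mono) (meson not_le)
    qed
  qed
  show "smallo_P M (\<lambda>n. 1 / sqrt (real n))
        (\<lambda>n \<omega>. SUP j\<in>{..N n}. SUP k\<in>chi (\<tau> n j). ennreal (lam n) / p k n (\<tau> n j) \<omega>)"
    unfolding smallo_P_def
  proof (intro allI impI outer_measure_tendsto_0_if_bigO_P[OF D])
    fix \<epsilon> C :: real
    assume \<epsilon>: "\<epsilon> > 0" and C: "C > 0"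
    have small: "\<forall>\<^sub>F n in sequentially. sqrt (real n) * lam n < \<epsilon> * \<delta>"
      using lam_upper \<epsilon> \<delta> by (intro order_tendstoD) auto
    have "(\<lambda>n. C * (1 / sqrt (real n))) \<longlonglongrightarrow> C * 0"
      by (intro tendsto_intros tendsto_divide_0[OF tendsto_const]
          filterlim_at_top_imp_at_infinity filterlim_compose[OF sqrt_at_top filterlim_real_sequentially])
    then have "\<forall>\<^sub>F n in sequentially. C * (1 / sqrt (real n)) < \<delta>"
      using \<delta> by (intro order_tendstoD) auto
    with small eventually_gt_at_top[of 0]
    show "\<forall>\<^sub>F n in sequentially.
        {\<omega> \<in> space M. ennreal (\<epsilon> * (1 / sqrt (real n))) <
          (SUP j\<in>{..N n}. SUP k\<in>chi (\<tau> n j). ennreal (lam n) / p k n (\<tau> n j) \<omega>)}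
        \<subseteq> {\<omega> \<in> space M. D n \<omega> > ennreal (C * (1 / sqrt (real n)))}"
    proof eventually_elim
      case (elim n)
      have "(SUP j\<in>{..N n}. SUP k\<in>chi (\<tau> n j). ennreal (lam n) / p k n (\<tau> n j) \<omega>)
          \<le> ennreal (\<epsilon> * (1 / sqrt (real n)))"
        if dev: "D n \<omega> \<le> ennreal (C * (1 / sqrt (real n)))" for \<omega>
      proof (intro SUP_least)
        fix j k
        assume jk: "j \<in> {..N n}" "k \<in> chi (\<tau> n j)"
        have "D n \<omega> \<le> ennreal \<delta>"
          using dev elim(3) by (meson ennreal_leI less_imp_le order_trans)
        then have "ennreal \<delta> \<le> p k n (\<tau> n j) \<omega>"
          using jk by (intro lower grid) auto
        then have "ennreal (lam n) / p k n (\<tau> n j) \<omega> \<le> ennreal (lam n) / ennreal \<delta>"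
          by (rule divide_left_antimono_ennreal)
        also have "\<dots> = ennreal (lam n / \<delta>)"
          using lam_pos[of n] \<delta> by (simp add: divide_ennreal)
        also have "\<dots> \<le> ennreal (\<epsilon> * (1 / sqrt (real n)))"
          using elim \<delta> by (intro ennreal_leI) (simp add: field_simps)
        finally show "ennreal (lam n) / p k n (\<tau> n j) \<omega> \<le> ennreal (\<epsilon> * (1 / sqrt (real n)))" .
      qed
      then show ?case
        by (intro Collect_mono) (meson not_le)
    qed
  qed
qed

section \<open>Cells of the partition\<close>

lemma breakpoints_cell:
  assumes "breakpoints a b m \<theta>" "a \<le> t" "t < b"
  obtains i where "i \<in> {1..<m}" "\<theta> i \<le> t" "t < \<theta> (Suc i)"
proof -
  \<comment> \<open>The first breakpoint beyond \<open>t\<close> is not \<open>\<theta> 1 = a\<close>, so it has a predecessor.\<close>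
  define l where "l = (LEAST l. t < \<theta> l \<and> 1 \<le> l)"
  have ex: "t < \<theta> m \<and> 1 \<le> m"
    using assms by (auto simp: breakpoints_def)
  have l: "t < \<theta> l \<and> 1 \<le> l" and lm: "l \<le> m"
    unfolding l_def using ex by (rule LeastI, rule Least_le)
  have "l \<noteq> 1"
    using l assms by (auto simp: breakpoints_def)
  with l have l2: "2 \<le> l" by auto
  have "\<not> (t < \<theta> (l - 1) \<and> 1 \<le> l - 1)"
    using l2 unfolding l_def by (intro not_less_Least) (auto simp: l_def[symmetric])
  then show thesis
    using l l2 lm by (intro that[of "l - 1"]) auto
qed

text \<open>
  The integral penalty can see a nonzero value of \<open>\<beta>\<^sub>k\<close> at \<open>t\<close> only if the cell of \<open>t\<close> has positive
  length next to \<open>t\<close>. The half-open interval \<open>[\<theta>\<^sub>i, \<theta>\<^sub>i\<^sub>+\<^sub>1)\<close> that contains \<open>t\<close> leaves room to the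
  right of \<open>t\<close>; for the right end point \<open>b\<close>, the closed last interval leaves room to the left.
\<close>

lemma interval_in_cell:
  assumes part: "interval_partition a b K T" and j: "j \<in> {1..K}" and t: "t \<in> T j"
  obtains u v where "u < v" "t \<in> {u..v}" "{u..v} \<subseteq> T j"
proof -
  obtain m \<theta> where bp: "breakpoints a b m \<theta>"
    and cell: "\<And>i. i \<in> {1..<m} \<Longrightarrow> \<exists>j\<in>{1..K}. {\<theta> i..<\<theta> (Suc i)} \<subseteq> T j"
    and last: "\<exists>j\<in>{1..K}. {\<theta> (m - 1)..b} \<subseteq> T j"
    using part unfolding interval_partition_def by metis
  have disj: "disjoint_family_on T {1..K}"
    using part by (simp add: interval_partition_def)
  have same: "j' = j" if "j' \<in> {1..K}" "t \<in> T j'" for j'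
    using disjoint_family_onD[OF disj that(1) j] that(2) t by blast
  have tab: "t \<in> {a..b}"
    using part j t by (auto simp: interval_partition_def)
  show thesis
  proof (cases "t = b")
    case True
    have "\<theta> (m - 1) < \<theta> m"
      using bp by (auto simp: breakpoints_def intro: strict_mono_onD)
    then have "\<theta> (m - 1) < b"
      using bp by (simp add: breakpoints_def)
    moreover from last obtain j' where "j' \<in> {1..K}" "{\<theta> (m - 1)..b} \<subseteq> T j'" by blast
    moreover from this True \<open>\<theta> (m - 1) < b\<close> have "j' = j" by (intro same) auto
    ultimately show thesis
      using True by (intro that[of "\<theta> (m - 1)" b]) auto
  next
    case False
    with tab obtain i where i: "i \<in> {1..<m}" "\<theta> i \<le> t" "t < \<theta> (Suc i)"
      using breakpoints_cell[OF bp, of t] by auto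
    from cell[OF i(1)] obtain j' where j': "j' \<in> {1..K}" "{\<theta> i..<\<theta> (Suc i)} \<subseteq> T j'" by blast
    then have "j' = j" using i by (intro same) auto
    with j' i show thesis
      by (intro that[of t "(t + \<theta> (Suc i)) / 2"]) (auto simp: subset_iff)
  qed
qed

text \<open>
  The factor \<open>2\<close> in the bound is a reserve: a perturbation of \<open>\<beta>\<close> by at most \<open>\<delta>\<close> still leaves
  the component at least \<open>\<delta>\<close> in absolute value.
\<close>

lemma Lipschitz_component_bounded_away:
  fixes \<beta> :: "real \<Rightarrow> real ^ 'd"
  assumes lip: "\<forall>s\<in>I. \<forall>t\<in>I. infnorm (\<beta> s - \<beta> t) \<le> C * \<bar>s - t\<bar>"
    and uv: "u < v" "{u..v} \<subseteq> I" and t: "t \<in> {u..v}" and nz: "\<beta> t $ k \<noteq> 0"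
  obtains u' v' \<delta> where "u' < v'" "{u'..v'} \<subseteq> {u..v}" "\<delta> > 0" "\<And>s. s \<in> {u'..v'} \<Longrightarrow> 2 * \<delta> \<le> \<bar>\<beta> s $ k\<bar>"
proof -
  \<comment> \<open>With a quarter of the value at \<open>t\<close>, a change by \<open>2 * \<delta>\<close> leaves \<open>2 * \<delta>\<close>; within distance
    \<open>r\<close> the Lipschitz bound allows no larger change. Adding \<open>1\<close> to \<open>\<bar>C\<bar>\<close> avoids a zero denominator.\<close>
  define \<delta> where "\<delta> = \<bar>\<beta> t $ k\<bar> / 4"
  define r where "r = 2 * \<delta> / (\<bar>C\<bar> + 1)"
  have pos: "\<delta> > 0" "r > 0"
    using nz by (auto simp: \<delta>_def r_def)
  have "2 * \<delta> \<le> \<bar>\<beta> s $ k\<bar>" if s: "s \<in> {max u (t - r)..min v (t + r)}" for s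
  proof -
    have "\<bar>\<beta> s $ k - \<beta> t $ k\<bar> \<le> infnorm (\<beta> s - \<beta> t)"
      using component_le_infnorm_cart[of "\<beta> s - \<beta> t" k] by simp
    also have "\<dots> \<le> C * \<bar>s - t\<bar>"
      using lip subsetD[OF uv(2), of s] subsetD[OF uv(2) t] s by auto
    also have "\<dots> \<le> (\<bar>C\<bar> + 1) * r"
      using s pos by (intro mult_mono) auto
    also have "\<dots> = 2 * \<delta>"
      by (simp add: r_def add_nonneg_eq_0_iff)
    finally show ?thesis
      unfolding \<delta>_def by linarith
  qed
  then show thesis
    using uv t pos by (intro that[of "max u (t - r)" "min v (t + r)" \<delta>]) auto
qed

section \<open>Penalties along one path\<close>

lemma component_le_deviation:
  fixes b \<beta> :: "real \<Rightarrow> real ^ 'd"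
  assumes "t \<in> I" "\<beta> t $ k = 0"
  shows "ennreal \<bar>b t $ k\<bar> \<le> (SUP s\<in>I. ennreal (infnorm (b s - \<beta> s)))"
proof -
  have "\<bar>b t $ k\<bar> \<le> infnorm (b t - \<beta> t)"
    using component_le_infnorm_cart[of "b t - \<beta> t" k] assms(2) by simp
  then show ?thesis
    using assms(1) by (intro SUP_upper2[of t]) (auto intro: ennreal_leI)
qed

lemma component_ge_if_deviation_le:
  fixes b \<beta> :: "real \<Rightarrow> real ^ 'd"
  assumes "(SUP s\<in>I. ennreal (infnorm (b s - \<beta> s))) \<le> ennreal \<delta>"
    and "\<delta> \<ge> 0" "t \<in> I" "2 * \<delta> \<le> \<bar>\<beta> t $ k\<bar>"
  shows "\<delta> \<le> \<bar>b t $ k\<bar>"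
proof -
  have "ennreal (infnorm (b t - \<beta> t)) \<le> ennreal \<delta>"
    using assms(1,3) by (auto simp: SUP_le_iff)
  then have "infnorm (b t - \<beta> t) \<le> \<delta>"
    using assms(2) by (simp add: ennreal_le_iff)
  with component_le_infnorm_cart[of "b t - \<beta> t" k] assms(4) show ?thesis
    by auto
qed

lemma sum_indicator_cell:
  fixes f :: "nat \<Rightarrow> ennreal"
  assumes "disjoint_family_on T {1..K}" "j \<in> {1..K}" "t \<in> T j"
  shows "(\<Sum>i=1..K. indicator (T i) t * f i) = f j"
proof -
  have "t \<notin> T i" if "i \<in> {1..K}" "i \<noteq> j" for i
    using disjoint_family_onD[OF assms(1) that(1) assms(2) that(2)] assms(3) by blast
  then have "(\<Sum>i=1..K. indicator (T i) t * f i) = (\<Sum>i=1..K. if i = j then f j else 0)"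
    using assms(3) by (intro sum.cong) auto
  also have "\<dots> = f j"
    using assms(2) by simp
  finally show ?thesis .
qed

lemma nn_integral_weight:
  fixes h :: "real \<Rightarrow> real"
  assumes pos: "\<forall>t\<in>I. h t > 0" and int: "set_integrable lborel I h"
    and int1: "(LINT t:I|lborel. h t) = 1"
  shows "(\<integral>\<^sup>+t. ennreal (indicator I t * h t) \<partial>lborel) = 1"
proof -
  have "(\<integral>\<^sup>+t. ennreal (indicator I t * h t) \<partial>lborel) = ennreal (\<integral>t. indicator I t * h t \<partial>lborel)"
    using int pos by (intro nn_integral_eq_integral)
      (auto simp: set_integrable_def less_imp_le split: split_indicator)
  then show ?thesis
    using int1 by (simp add: set_lebesgue_integral_def)
qed

text \<open>
  The integral penalty is a weighted mean over the cell with total weight at most \<open>1\<close>. The path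
  \<open>b\<close> may fail to be measurable; its integral is then a lower integral, for which monotonicity
  still holds, and linearity is only applied to the measurable bound \<open>D * h\<close>.
\<close>

lemma integral_penalty_le:
  fixes b :: "real \<Rightarrow> real ^ 'd" and D :: ennreal
  assumes pos: "\<forall>t\<in>I. h t > 0" and int: "set_integrable lborel I h"
    and int1: "(LINT t:I|lborel. h t) = 1"
    and T: "T \<subseteq> I" and le: "\<And>t. t \<in> T \<Longrightarrow> ennreal \<bar>b t $ k\<bar> \<le> D"
  shows "(\<integral>\<^sup>+t\<in>T. ennreal (\<bar>b t $ k\<bar> * h t) \<partial>lborel) \<le> D"
proof -
  have meas [measurable]: "(\<lambda>t. ennreal (indicator I t * h t)) \<in> borel_measurable lborel"
    using int by (auto simp: set_integrable_def)
  have "(\<integral>\<^sup>+t\<in>T. ennreal (\<bar>b t $ k\<bar> * h t) \<partial>lborel)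
      \<le> (\<integral>\<^sup>+t. D * ennreal (indicator I t * h t) \<partial>lborel)"
    using T pos le
    by (intro nn_integral_mono)
      (auto split: split_indicator simp: ennreal_mult' intro!: mult_right_mono)
  also have "\<dots> = D"
    using meas by (subst nn_integral_cmult) (simp_all add: nn_integral_weight[OF pos int int1])
  finally show ?thesis .
qed

lemma weight_measurable:
  fixes h :: "real \<Rightarrow> real"
  assumes int: "set_integrable lborel I h" and uv: "{u..v} \<subseteq> I"
  shows "(\<lambda>t. ennreal (h t) * indicator {u..v} t) \<in> borel_measurable lborel"
proof -
  have h: "(\<lambda>t. ennreal (indicator I t * h t)) \<in> borel_measurable lborel"
    using int by (auto simp: set_integrable_def)
  have eq: "(\<lambda>t. ennreal (h t) * indicator {u..v} t)
      = (\<lambda>t. ennreal (indicator I t * h t) * indicator {u..v} t)"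
    using uv by (auto simp: fun_eq_iff subset_iff split: split_indicator)
  show ?thesis
    unfolding eq using h by measurable
qed

lemma integral_weight_pos:
  fixes h :: "real \<Rightarrow> real"
  assumes pos: "\<forall>t\<in>I. h t > 0" and int: "set_integrable lborel I h"
    and uv: "u < v" "{u..v} \<subseteq> I"
  obtains c where "c > 0" "ennreal c \<le> (\<integral>\<^sup>+t\<in>{u..v}. ennreal (h t) \<partial>lborel)"
proof -
  have meas: "(\<lambda>t. ennreal (h t) * indicator {u..v} t) \<in> borel_measurable lborel"
    using int uv(2) by (rule weight_measurable)
  have "(\<integral>\<^sup>+t\<in>{u..v}. ennreal (h t) \<partial>lborel) \<noteq> 0"
  proof
    assume "(\<integral>\<^sup>+t\<in>{u..v}. ennreal (h t) \<partial>lborel) = 0"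
    then have "AE t in lborel. ennreal (h t) * indicator {u..v} t = 0"
      using meas by (simp add: nn_integral_0_iff_AE)
    then have "AE t in lborel. t \<notin> {u..v}"
    proof (rule eventually_mono)
      fix t
      assume "ennreal (h t) * indicator {u..v} t = 0"
      then show "t \<notin> {u..v}"
        using pos uv(2) by (fastforce simp: ennreal_eq_0_iff)
    qed
    then have "emeasure lborel {u..v} = 0"
      using AE_iff_measurable[of "{u..v}" lborel "\<lambda>t. t \<notin> {u..v}"] by (auto simp: set_eq_iff)
    with uv(1) show False by simp
  qed
  then obtain e where "0 < e" "e < (\<integral>\<^sup>+t\<in>{u..v}. ennreal (h t) \<partial>lborel)"
    using dense by (metis not_gr_zero)
  then show thesis
    by (cases e) (auto intro!: that less_imp_le)
qed

text \<open>
  Discarding the cell outside \<open>[u, v]\<close> and replacing the path by the constant \<open>\<delta>\<close> inside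
  gives a measurable minorant, to which linearity of the integral applies.
\<close>

lemma integral_penalty_ge:
  fixes b :: "real \<Rightarrow> real ^ 'd"
  assumes pos: "\<forall>t\<in>I. h t > 0" and T: "{u..v} \<subseteq> T" "T \<subseteq> I"
    and c: "ennreal c \<le> (\<integral>\<^sup>+t\<in>{u..v}. ennreal (h t) \<partial>lborel)"
    and int: "set_integrable lborel I h"
    and \<delta>: "\<delta> \<ge> 0" and ge: "\<And>t. t \<in> {u..v} \<Longrightarrow> \<delta> \<le> \<bar>b t $ k\<bar>"
  shows "ennreal (\<delta> * c) \<le> (\<integral>\<^sup>+t\<in>T. ennreal (\<bar>b t $ k\<bar> * h t) \<partial>lborel)"
proof -
  have meas: "(\<lambda>t. ennreal (h t) * indicator {u..v} t) \<in> borel_measurable lborel"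
    using int order_trans[OF T] by (rule weight_measurable)
  have "ennreal (\<delta> * c) = ennreal \<delta> * ennreal c"
    using \<delta> by (simp add: ennreal_mult')
  also have "\<dots> \<le> ennreal \<delta> * (\<integral>\<^sup>+t\<in>{u..v}. ennreal (h t) \<partial>lborel)"
    using c by (rule mult_left_mono) simp
  also have "\<dots> = (\<integral>\<^sup>+t. ennreal \<delta> * (ennreal (h t) * indicator {u..v} t) \<partial>lborel)"
    using meas by (rule nn_integral_cmult[symmetric])
  also have "\<dots> \<le> (\<integral>\<^sup>+t\<in>T. ennreal (\<bar>b t $ k\<bar> * h t) \<partial>lborel)"
    using T pos \<delta> ge
    by (intro nn_integral_mono)
      (auto split: split_indicator simp: ennreal_mult'[symmetric] subset_iff less_imp_le
        intro!: ennreal_leI mult_right_mono)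
  finally show ?thesis .
qed

section \<open>From bounds on the cells to condition (P)\<close>

lemma uniform_threshold:
  fixes P :: "'a \<Rightarrow> real \<Rightarrow> bool"
  assumes "finite S" "\<forall>x\<in>S. \<exists>\<delta>>0. P x \<delta>"
    and "\<And>x \<delta> \<delta>'. P x \<delta> \<Longrightarrow> 0 < \<delta>' \<Longrightarrow> \<delta>' \<le> \<delta> \<Longrightarrow> P x \<delta>'"
  shows "\<exists>\<delta>>0. \<forall>x\<in>S. P x \<delta>"
  using assms(1,2)
proof (induction rule: finite_induct)
  case empty
  show ?case by (auto intro: exI[of _ 1])
next
  case (insert x S)
  then obtain \<delta> \<delta>' where "\<delta> > 0" "\<forall>x\<in>S. P x \<delta>" "\<delta>' > 0" "P x \<delta>'"
    by auto
  then show ?case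
    using assms(3) by (intro exI[of _ "min \<delta> \<delta>'"]) (auto simp: min_le_iff_disj)
qed

text \<open>
  The integral and the maximum penalty enter only through two comparisons with the deviation \<open>D\<close>
  of the preliminary estimator: \<open>D\<close> dominates the penalty of an inactive component, and a small
  \<open>D\<close> keeps the penalty of an active component away from \<open>0\<close>. Using the same \<open>\<delta>\<close> as the bound
  on \<open>D\<close> and on the penalty makes the second property inherited by smaller \<open>\<delta>\<close>, so that one
  \<open>\<delta>\<close> can be chosen for the finitely many pairs of a cell and an active component.
\<close>

lemma condition_P_if_cellwise_bounds:
  fixes D :: "nat \<Rightarrow> 'w \<Rightarrow> ennreal" and p :: "'d::finite \<Rightarrow> nat \<Rightarrow> real \<Rightarrow> 'w \<Rightarrow> ennreal"
  assumes part: "interval_partition a b K T"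
    and chi: "\<And>j t. j \<in> {1..K} \<Longrightarrow> t \<in> T j \<Longrightarrow> chi t = J j"
    and zero: "\<And>j k t. j \<in> {1..K} \<Longrightarrow> k \<notin> J j \<Longrightarrow> t \<in> T j \<Longrightarrow> \<beta> t $ k = 0"
    and grid: "uniform_grid a b w N \<tau>"
    and D: "bigO_P M (\<lambda>n. 1 / sqrt (real n)) D"
    and lam: "\<And>n. lam n > 0" "(\<lambda>n. sqrt (real n) * lam n) \<longlonglongrightarrow> 0"
      "filterlim (\<lambda>n. real n * lam n) at_top sequentially"
    and upper: "\<And>j k n t \<omega>. j \<in> {1..K} \<Longrightarrow> k \<notin> J j \<Longrightarrow> t \<in> T j \<Longrightarrow> p k n t \<omega> \<le> D n \<omega>"
    and lower: "\<And>j k. j \<in> {1..K} \<Longrightarrow> k \<in> J j \<Longrightarrow>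
      \<exists>\<delta>>0. \<forall>n t \<omega>. t \<in> T j \<longrightarrow> D n \<omega> \<le> ennreal \<delta> \<longrightarrow> ennreal \<delta> \<le> p k n t \<omega>"
  shows "condition_P M a b \<beta> lam N \<tau> p chi"
proof -
  have cover: "\<exists>j\<in>{1..K}. t \<in> T j" if "t \<in> {a..b}" for t
    using part that by (auto simp: interval_partition_def)
  have tau: "\<tau> n j \<in> {a..b}" if "j \<le> N n" for n j
  proof -
    have "0 \<le> real j * w n" "real j * w n \<le> real (N n) * w n"
      using grid that by (auto simp: uniform_grid_def less_imp_le intro!: mult_right_mono)
    moreover have "\<tau> n j = a + real j * w n" "b = a + real (N n) * w n"
      using grid that unfolding uniform_grid_def by (blast, metis order_refl)
    ultimately show ?thesis by auto
  qed
  define S where "S = Sigma {1..K} J"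
  have "finite S"
    unfolding S_def by (intro finite_SigmaI) auto
  moreover have "\<forall>x\<in>S. \<exists>\<delta>>0. \<forall>n t \<omega>. t \<in> T (fst x) \<longrightarrow> D n \<omega> \<le> ennreal \<delta> \<longrightarrow> ennreal \<delta> \<le> p (snd x) n t \<omega>"
    using lower by (auto simp: S_def)
  ultimately have "\<exists>\<delta>>0. \<forall>x\<in>S. \<forall>n t \<omega>. t \<in> T (fst x) \<longrightarrow> D n \<omega> \<le> ennreal \<delta> \<longrightarrow> ennreal \<delta> \<le> p (snd x) n t \<omega>"
  proof (rule uniform_threshold)
    fix x and \<delta> \<delta>' :: real
    assume *: "\<forall>n t \<omega>. t \<in> T (fst x) \<longrightarrow> D n \<omega> \<le> ennreal \<delta> \<longrightarrow> ennreal \<delta> \<le> p (snd x) n t \<omega>"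
      and "\<delta>' \<le> \<delta>"
    then have "ennreal \<delta>' \<le> ennreal \<delta>" by (intro ennreal_leI)
    with * show "\<forall>n t \<omega>. t \<in> T (fst x) \<longrightarrow> D n \<omega> \<le> ennreal \<delta>' \<longrightarrow> ennreal \<delta>' \<le> p (snd x) n t \<omega>"
      by (meson order_trans)
  qed
  then obtain \<delta> where \<delta>: "\<delta> > 0"
    and low: "\<And>j k n t \<omega>. j \<in> {1..K} \<Longrightarrow> k \<in> J j \<Longrightarrow> t \<in> T j \<Longrightarrow> D n \<omega> \<le> ennreal \<delta> \<Longrightarrow> ennreal \<delta> \<le> p k n t \<omega>"
    by (auto simp: S_def)
  have up: "p k n t \<omega> \<le> D n \<omega>" if "t \<in> {a..b}" "k \<notin> chi t" for k n t \<omega>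
    using cover[OF that(1)] that(2) chi upper by blast
  have lo: "ennreal \<delta> \<le> p k n t \<omega>" if "t \<in> {a..b}" "k \<in> chi t" "D n \<omega> \<le> ennreal \<delta>" for k n t \<omega>
    using cover[OF that(1)] that(2,3) chi low by blast
  have "\<exists>m \<theta>. breakpoints a b m \<theta> \<and> (\<forall>i\<in>{1..<m}. \<exists>j\<in>{1..K}. {\<theta> i..<\<theta> (Suc i)} \<subseteq> T j)"
    using part unfolding interval_partition_def by blast
  then have "\<exists>m \<theta>. breakpoints a b m \<theta> \<and> (\<forall>i\<in>{1..<m}. chi constant_on {\<theta> i..<\<theta> (Suc i)})"
    unfolding constant_on_def using chi by (meson subsetD)
  moreover have "\<forall>t\<in>{a..b}. \<forall>k\<in>- chi t. \<beta> t $ k = 0"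
    using cover chi zero by (metis ComplD)
  moreover note penalty_orders_if_deviation_bounds[where I = "{a..b}" and p = p and chi = chi,
      OF D lam tau up \<delta> lo]
  ultimately show ?thesis
    unfolding condition_P_def by (intro conjI)
qed

section \<open>Average penalties\<close>

theorem lemma4p15:
  fixes M :: "'w measure"
    and \<tau>\<^sub>L \<tau>\<^sub>U C\<^sub>4 :: real
    and \<beta> :: "real \<Rightarrow> real ^ 'd"
    and \<beta>' :: "nat \<Rightarrow> 'w \<Rightarrow> real \<Rightarrow> real ^ 'd"
    and K :: nat
    and \<T> :: "nat \<Rightarrow> real set"
    and \<J> :: "nat \<Rightarrow> 'd set"
    and h :: "real \<Rightarrow> real"
    and lam a :: "nat \<Rightarrow> real"
    and N :: "nat \<Rightarrow> nat"
    and \<tau> :: "nat \<Rightarrow> nat \<Rightarrow> real"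
  assumes "prob_space M"
    and "0 \<le> \<tau>\<^sub>L" "\<tau>\<^sub>L < \<tau>\<^sub>U" "\<tau>\<^sub>U < 1"
    and lipschitz: "\<forall>s\<in>{\<tau>\<^sub>L..\<tau>\<^sub>U}. \<forall>t\<in>{\<tau>\<^sub>L..\<tau>\<^sub>U}. infnorm (\<beta> s - \<beta> t) \<le> C\<^sub>4 * \<bar>s - t\<bar>"
    and partition: "interval_partition \<tau>\<^sub>L \<tau>\<^sub>U K \<T>"
    and h_pos: "\<forall>t\<in>{\<tau>\<^sub>L..\<tau>\<^sub>U}. h t > 0"
    and h_bounded: "bounded (h ` {\<tau>\<^sub>L..\<tau>\<^sub>U})"
    and h_integrable: "set_integrable lborel {\<tau>\<^sub>L..\<tau>\<^sub>U} h"
    and h_integral: "(LINT t:{\<tau>\<^sub>L..\<tau>\<^sub>U}|lborel. h t) = 1"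
    and lam_pos: "\<forall>n. lam n > 0"
    and grid: "uniform_grid \<tau>\<^sub>L \<tau>\<^sub>U a N \<tau>"
    and grid_width: "a \<in> o(\<lambda>n. 1 / sqrt (real n))"
    and J_nonzero: "(INF j\<in>{1..K}. INF k\<in>\<J> j. SUP t\<in>\<T> j. ennreal \<bar>\<beta> t $ k\<bar>) > 0"
    and J_zero: "(SUP j\<in>{1..K}. SUP k\<in>- \<J> j. SUP t\<in>\<T> j. ennreal \<bar>\<beta> t $ k\<bar>) = 0"
    and lam_upper: "(\<lambda>n. sqrt (real n) * lam n) \<longlonglongrightarrow> 0"
    and lam_lower: "filterlim (\<lambda>n. real n * lam n) at_top sequentially"
    and preliminary: "bigO_P M (\<lambda>n. 1 / sqrt (real n))
          (\<lambda>n \<omega>. SUP t\<in>{\<tau>\<^sub>L..\<tau>\<^sub>U}. ennreal (infnorm (\<beta>' n \<omega> t - \<beta> t)))"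
  shows "\<exists>chi. (\<forall>j\<in>{1..K}. \<forall>t\<in>\<T> j. chi t = \<J> j) \<and>
           condition_P M \<tau>\<^sub>L \<tau>\<^sub>U \<beta> lam N \<tau> (p_int K \<T> h \<beta>') chi \<and>
           condition_P M \<tau>\<^sub>L \<tau>\<^sub>U \<beta> lam N \<tau> (p_max K \<T> \<beta>') chi"
proof -
  let ?I = "{\<tau>\<^sub>L..\<tau>\<^sub>U}"
  let ?D = "\<lambda>n \<omega>. SUP t\<in>?I. ennreal (infnorm (\<beta>' n \<omega> t - \<beta> t))"
  have disj: "disjoint_family_on \<T> {1..K}" and sub: "\<T> j \<subseteq> ?I" if "j \<in> {1..K}" for j
    using partition that by (auto simp: interval_partition_def)
  have zero: "\<beta> t $ k = 0" if "j \<in> {1..K}" "k \<notin> \<J> j" "t \<in> \<T> j" for j k t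
  proof -
    have "ennreal \<bar>\<beta> t $ k\<bar> \<le> (SUP j\<in>{1..K}. SUP k\<in>- \<J> j. SUP t\<in>\<T> j. ennreal \<bar>\<beta> t $ k\<bar>)"
      using that by (intro SUP_upper2[OF that(1)] SUP_upper2[of k] SUP_upper2[OF that(3)]) auto
    then show ?thesis
      using J_zero by simp
  qed
  have witness: "\<exists>u v \<delta>. u < v \<and> {u..v} \<subseteq> \<T> j \<and> \<delta> > 0 \<and> (\<forall>s\<in>{u..v}. 2 * \<delta> \<le> \<bar>\<beta> s $ k\<bar>)"
    if "j \<in> {1..K}" "k \<in> \<J> j" for j k
  proof -
    have "0 < (INF j\<in>{1..K}. INF k\<in>\<J> j. SUP t\<in>\<T> j. ennreal \<bar>\<beta> t $ k\<bar>)"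
      by (fact J_nonzero)
    also have "\<dots> \<le> (SUP t\<in>\<T> j. ennreal \<bar>\<beta> t $ k\<bar>)"
      using that by (intro INF_lower2[OF that(1)] INF_lower2[OF that(2)]) auto
    finally obtain t where t: "t \<in> \<T> j" "\<beta> t $ k \<noteq> 0"
      by (auto simp: less_SUP_iff)
    obtain u v where uv: "u < v" "t \<in> {u..v}" "{u..v} \<subseteq> \<T> j"
      by (rule interval_in_cell[OF partition \<open>j \<in> {1..K}\<close> t(1)])
    obtain u' v' \<delta> where "u' < v'" "{u'..v'} \<subseteq> {u..v}" "\<delta> > 0"
      "\<And>s. s \<in> {u'..v'} \<Longrightarrow> 2 * \<delta> \<le> \<bar>\<beta> s $ k\<bar>"
      using Lipschitz_component_bounded_away[OF lipschitz uv(1) order_trans[OF uv(3) sub[OF \<open>j \<in> {1..K}\<close>]] uv(2) t(2)]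
      by blast
    with uv(3) show ?thesis by blast
  qed
  define chi where "chi t = \<J> (THE j. j \<in> {1..K} \<and> t \<in> \<T> j)" for t
  have chi: "chi t = \<J> j" if "j \<in> {1..K}" "t \<in> \<T> j" for j t
  proof -
    have "i = j" if "i \<in> {1..K}" "t \<in> \<T> i" for i
      using disjoint_family_onD[OF disj[OF that(1)] that(1) \<open>j \<in> {1..K}\<close>] that(2) \<open>t \<in> \<T> j\<close> by blast
    with that have "(THE j. j \<in> {1..K} \<and> t \<in> \<T> j) = j"
      by (metis (no_types, lifting) the_equality)
    then show ?thesis by (simp add: chi_def)
  qed
  have p_int: "p_int K \<T> h \<beta>' k n t \<omega> = (\<integral>\<^sup>+t\<in>\<T> j. ennreal (\<bar>\<beta>' n \<omega> t $ k\<bar> * h t) \<partial>lborel)"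
    and p_max: "p_max K \<T> \<beta>' k n t \<omega> = (SUP t\<in>\<T> j. ennreal \<bar>\<beta>' n \<omega> t $ k\<bar>)"
    if "j \<in> {1..K}" "t \<in> \<T> j" for j k n t \<omega>
    unfolding p_int_def p_max_def
    by (rule sum_indicator_cell[OF disj[OF that(1)] that])+
  have "condition_P M \<tau>\<^sub>L \<tau>\<^sub>U \<beta> lam N \<tau> (p_int K \<T> h \<beta>') chi"
  proof (rule condition_P_if_cellwise_bounds[OF partition chi zero grid preliminary lam_pos[rule_format]
        lam_upper lam_lower])
    fix j k n t \<omega>
    assume j: "j \<in> {1..K}" and k: "k \<notin> \<J> j" and t: "t \<in> \<T> j"
    show "p_int K \<T> h \<beta>' k n t \<omega> \<le> ?D n \<omega>"
      unfolding p_int[OF j t]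
      using sub[OF j] zero[OF j k]
      by (intro integral_penalty_le[OF h_pos h_integrable h_integral] component_le_deviation) auto
  next
    fix j k
    assume j: "j \<in> {1..K}" and k: "k \<in> \<J> j"
    obtain u v \<delta> where uv: "u < v" "{u..v} \<subseteq> \<T> j" and \<delta>: "\<delta> > 0"
      and big: "\<forall>s\<in>{u..v}. 2 * \<delta> \<le> \<bar>\<beta> s $ k\<bar>"
      using witness[OF j k] by blast
    obtain c where c: "c > 0" "ennreal c \<le> (\<integral>\<^sup>+t\<in>{u..v}. ennreal (h t) \<partial>lborel)"
      using integral_weight_pos[OF h_pos h_integrable uv(1) order_trans[OF uv(2) sub[OF j]]] .
    \<comment> \<open>A single number has to bound both the deviation, by \<open>\<delta>\<close>, and the penalty, by the
      possibly different value \<open>\<delta> * c\<close>; the minimum does both.\<close>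
    have "ennreal (min \<delta> (\<delta> * c)) \<le> p_int K \<T> h \<beta>' k n t \<omega>"
      if t: "t \<in> \<T> j" and D: "?D n \<omega> \<le> ennreal (min \<delta> (\<delta> * c))" for n t \<omega>
    proof -
      have "?D n \<omega> \<le> ennreal \<delta>"
        using D by (rule order_trans) (auto intro: ennreal_leI)
      then have "\<delta> \<le> \<bar>\<beta>' n \<omega> s $ k\<bar>" if "s \<in> {u..v}" for s
        using less_imp_le[OF \<delta>] subsetD[OF sub[OF j] subsetD[OF uv(2) that]] bspec[OF big that]
        by (rule component_ge_if_deviation_le)
      then have "ennreal (\<delta> * c) \<le> p_int K \<T> h \<beta>' k n t \<omega>"
        unfolding p_int[OF j t]
        by (rule integral_penalty_ge[OF h_pos uv(2) sub[OF j] c(2) h_integrable less_imp_le[OF \<delta>]])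
      then show ?thesis
        by (rule order_trans[rotated]) (auto intro: ennreal_leI)
    qed
    moreover have "min \<delta> (\<delta> * c) > 0"
      using \<delta> c by simp
    ultimately show "\<exists>\<delta>>0. \<forall>n t \<omega>. t \<in> \<T> j \<longrightarrow> ?D n \<omega> \<le> ennreal \<delta> \<longrightarrow>
        ennreal \<delta> \<le> p_int K \<T> h \<beta>' k n t \<omega>"
      by blast
  qed
  moreover have "condition_P M \<tau>\<^sub>L \<tau>\<^sub>U \<beta> lam N \<tau> (p_max K \<T> \<beta>') chi"
  proof (rule condition_P_if_cellwise_bounds[OF partition chi zero grid preliminary lam_pos[rule_format]
        lam_upper lam_lower])
    fix j k n t \<omega>
    assume j: "j \<in> {1..K}" and k: "k \<notin> \<J> j" and t: "t \<in> \<T> j"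
    show "p_max K \<T> \<beta>' k n t \<omega> \<le> ?D n \<omega>"
      unfolding p_max[OF j t]
      using sub[OF j] zero[OF j k] by (intro SUP_least component_le_deviation) auto
  next
    fix j k
    assume j: "j \<in> {1..K}" and k: "k \<in> \<J> j"
    obtain u v \<delta> where uv: "u < v" "{u..v} \<subseteq> \<T> j" and \<delta>: "\<delta> > 0"
      and big: "\<forall>s\<in>{u..v}. 2 * \<delta> \<le> \<bar>\<beta> s $ k\<bar>"
      using witness[OF j k] by blast
    have u: "u \<in> \<T> j" "u \<in> ?I" "2 * \<delta> \<le> \<bar>\<beta> u $ k\<bar>"
      using subsetD[OF uv(2), of u] subsetD[OF sub[OF j], of u] uv(1) big by auto
    have "ennreal \<delta> \<le> p_max K \<T> \<beta>' k n t \<omega>"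
      if t: "t \<in> \<T> j" and D: "?D n \<omega> \<le> ennreal \<delta>" for n t \<omega>
      unfolding p_max[OF j t]
      using component_ge_if_deviation_le[OF D less_imp_le[OF \<delta>] u(2,3)]
      by (intro SUP_upper2[OF u(1)] ennreal_leI)
    with \<delta> show "\<exists>\<delta>>0. \<forall>n t \<omega>. t \<in> \<T> j \<longrightarrow> ?D n \<omega> \<le> ennreal \<delta> \<longrightarrow>
        ennreal \<delta> \<le> p_max K \<T> \<beta>' k n t \<omega>"
      by blast
  qed
  ultimately show ?thesis
    using chi by blast
qed

end
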